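(* Let $z=-1+i\sqrt{3}\in\mathbb{C}$, $X=\{z^n : n\in\mathbb{N}\}$, $d(x,y)=|x-y|$ and $T\colon X\to X$, $T(x)=zx$. Then $(X,d)$ is a complete metric space and $T$ does not have fixed points. Furthermore, let $D$ be any one of the following expressions, the exponents $a,b$ being fixed integers satisfying the indicated constraints: (i) $D(x,y)=d(T^a x,T^b y)$ with $a\ge 3$, $b\ge 0$, $a\ne b+1$; (ii) $D(x,y)=d(T^a x,T^b y)$ with $a\ge 0$, $b\ge 2$, $a\ne b+1$; (iii) $D(x,y)=d(T^a x,T^b x)$ with $a\ge 3$, $b\ge 0$, $a\neq b$; (iv) $D(x,y)=d(T^a y,T^b y)$ with $a\ge 2$, $b\ge 0$, $a\ne b$. Then there exists $q\in(0,1)$ such that for all $x,y\in X$ \[ d(Tx,Ty)\le q\cdot\max\{d(x,y),\,d(Tx,x),\,d(Tx,y),\,d(Ty,x),\,d(Ty,y),\,d(T^2x,x),\,d(T^2x,y),\,d(T^2x,Tx),\,d(T^2x,Ty),\,D(x,y)\}. \]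
   Context: $\mathbb{N}$ is the set of natural numbers. For an integer $k\ge 0$, $T^k$ denotes the $k$-th iterate of $T$ (with $T^0$ the identity), and $Tx$ means $T(x)$. $|\cdot|$ is the complex modulus. *)

theory Defs
  imports "HOL-Analysis.Analysis"
begin

definition zc :: complex where
  "zc = - 1 + \<i> * complex_of_real (sqrt 3)"

definition X :: "complex set" where
  "X = {zc ^ n | n :: nat. True}"

definition d :: "complex \<Rightarrow> complex \<Rightarrow> real" where
  "d x y = cmod (x - y)"

text \<open>\<open>T\<close> is given on all of the complex plane; it is only ever considered on \<open>X\<close>.\<close>

definition T :: "complex \<Rightarrow> complex" where
  "T x = zc * x"

definition extra_terms :: "(complex \<Rightarrow> complex \<Rightarrow> real) set" where
  "extra_terms =
     {(\<lambda>x y. d ((T ^^ a) x) ((T ^^ b) y)) | a b :: nat. a \<ge> 3 \<and> b \<ge> 0 \<and> a \<noteq> b + 1} \<union>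
     {(\<lambda>x y. d ((T ^^ a) x) ((T ^^ b) y)) | a b :: nat. a \<ge> 0 \<and> b \<ge> 2 \<and> a \<noteq> b + 1} \<union>
     {(\<lambda>x y. d ((T ^^ a) x) ((T ^^ b) x)) | a b :: nat. a \<ge> 3 \<and> b \<ge> 0 \<and> a \<noteq> b} \<union>
     {(\<lambda>x y. d ((T ^^ a) y) ((T ^^ b) y)) | a b :: nat. a \<ge> 2 \<and> b \<ge> 0 \<and> a \<noteq> b}"

end

theory Submission
  imports Defs
begin

text \<open>
  Write \<open>z = 2 \<omega>\<close> with \<open>\<omega>\<close> a primitive cube root of unity, so that \<open>\<bar>z\<bar> = 2\<close> and
  \<open>\<bar>z - 1\<bar> = \<surd>7\<close>. Distinct points of \<open>X\<close> have distance at least \<open>1\<close>, whence completeness.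
  By homogeneity only the exponent \<open>k\<close> in \<open>y = z\<^sup>k x\<close> matters for the inequality: for \<open>k < 0\<close>
  the term \<open>d(T\<^sup>2x, Tx) = 2\<surd>7\<bar>x\<bar>\<close> suffices, for \<open>k \<ge> 2\<close> the term \<open>d(Ty, y) = \<surd>7\<bar>y\<bar>\<close> does,
  and for \<open>k = 1\<close> the left-hand side is \<open>2\<surd>7\<bar>x\<bar>\<close>, whereas \<open>D(x, y)\<close> is
  \<open>\<bar>z\<^sup>a - z\<^sup>c\<bar>\<bar>x\<bar> \<ge> 6\<bar>x\<bar>\<close> for some \<open>a \<noteq> c\<close> with \<open>max a c \<ge> 3\<close>.
  In all cases \<open>q = 19/20\<close> works.
\<close>

lemma norm_zc [simp]: "cmod zc = 2"
  by (simp add: zc_def cmod_def)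

lemma norm_zc_minus_1: "cmod (zc - 1) = sqrt 7"
  by (simp add: zc_def cmod_def)

text \<open>Both constants come from \<open>q = 19/20\<close>: the lower bound is
  \<open>(5/2) / q\<close>, needed when \<open>y\<close> is at least four times as large as
  \<open>x\<close>, and the upper bound is \<open>6 * q / 2\<close>, needed when
  \<open>y = zc * x\<close>.\<close>

lemma sqrt_7_bounds: "50 / 19 \<le> sqrt 7" "sqrt 7 \<le> 57 / 20"
  by (rule real_le_rsqrt real_le_lsqrt; simp add: power2_eq_square)+

lemma norm_zc_power_diff_ge:
  assumes "m < n"
  shows "2 ^ n / 2 \<le> cmod (zc ^ n - zc ^ m)"
proof -
  have "(2::real) ^ Suc m \<le> 2 ^ n"
    using assms by (intro power_increasing) auto
  moreover have "2 ^ n - 2 ^ m \<le> cmod (zc ^ n - zc ^ m)"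
    using norm_triangle_ineq2[of "zc ^ n" "zc ^ m"] by (simp add: norm_power)
  ultimately show ?thesis by simp
qed

lemma norm_zc_power_diff_ge_6:
  assumes "m < n" "3 \<le> n"
  shows "6 \<le> cmod (zc ^ n - zc ^ m)"
proof (cases "n = Suc m")
  case True
  \<comment> \<open>For consecutive exponents the reverse triangle inequality would only give
    \<open>2 ^ m\<close>, possibly 4, so \<open>zc - 1\<close> is factored out instead.\<close>
  have "(2::real) ^ 2 \<le> 2 ^ m"
    using assms True by (intro power_increasing) auto
  moreover have "cmod (zc ^ n - zc ^ m) = 2 ^ m * sqrt 7"
  proof -
    have "zc ^ n - zc ^ m = zc ^ m * (zc - 1)"
      using True by (simp add: algebra_simps)
    then show ?thesis
      by (simp add: norm_mult norm_power norm_zc_minus_1)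
  qed
  moreover have "4 * 2 \<le> (2::real) ^ m * sqrt 7"
    using calculation(1) sqrt_7_bounds(1) by (intro mult_mono) auto
  ultimately show ?thesis by linarith
next
  case False
  \<comment> \<open>A gap of at least two leaves \<open>3/4 * 2 ^ n\<close>, which is at least
    6.\<close>
  have "(2::real) ^ (m + 2) \<le> 2 ^ n" "(2::real) ^ 3 \<le> 2 ^ n"
    using assms False by (intro power_increasing; simp)+
  moreover have "2 ^ n - 2 ^ m \<le> cmod (zc ^ n - zc ^ m)"
    using norm_triangle_ineq2[of "zc ^ n" "zc ^ m"] by (simp add: norm_power)
  ultimately show ?thesis by (simp add: power_add)
qed

lemma norm_zc_power_diff_ge_6':
  assumes "m \<noteq> n" "3 \<le> m \<or> 3 \<le> n"
  shows "6 \<le> cmod (zc ^ m - zc ^ n)"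
  using assms norm_zc_power_diff_ge_6[of m n] norm_zc_power_diff_ge_6[of n m]
  by (cases "m < n") (auto simp: norm_minus_commute)

lemma d_ge_1:
  assumes "x \<in> X" "y \<in> X" "x \<noteq> y"
  shows "1 \<le> d x y"
proof -
  have *: "1 \<le> cmod (zc ^ n - zc ^ m)" if "m < n" for m n
  proof -
    have "(2::real) ^ 1 \<le> 2 ^ n"
      using that by (intro power_increasing) auto
    then show ?thesis
      using norm_zc_power_diff_ge[OF that] by simp
  qed
  obtain m n where "x = zc ^ m" "y = zc ^ n"
    using assms by (auto simp: X_def)
  then show ?thesis
    using *[of m n] *[of n m] assms(3)
    by (cases m n rule: linorder_cases) (auto simp: d_def norm_minus_commute)
qed

lemma Metric_space_X: "Metric_space X d"
  by unfold_locales
    (auto simp: d_def norm_minus_commute, metis dist_norm dist_triangle)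

lemma mcomplete_X: "Metric_space.mcomplete X d"
proof -
  interpret Metric_space X d by (rule Metric_space_X)
  show ?thesis
    unfolding mcomplete_def
  proof (intro allI impI)
    fix s assume s: "MCauchy s"
    then have sX: "s n \<in> X" for n by (auto simp: MCauchy_def)
    from s obtain N where N: "\<And>m n. N \<le> m \<Longrightarrow> N \<le> n \<Longrightarrow> d (s m) (s n) < 1"
      unfolding MCauchy_def by (meson zero_less_one)
    \<comment> \<open>Points closer than 1 coincide, so the sequence is eventually constant.\<close>
    have const: "s n = s N" if "N \<le> n" for n
      using d_ge_1[OF sX sX, of n N] N[OF that order_refl] by force
    show "\<exists>x. limitin mtopology s x sequentially"
      unfolding limit_metric_sequentially using sX const by (metis mdist_zero)
  qed
qed

lemma T_funpow: "(T ^^ n) x = zc ^ n * x"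
  by (induction n) (auto simp: T_def)

lemma X_nonzero: "x \<in> X \<Longrightarrow> x \<noteq> 0"
  using norm_zc by (force simp: X_def)

lemma extra_term_ge:
  assumes "D \<in> extra_terms"
  shows "6 * cmod x \<le> D x (zc * x)"
proof -
  have scale: "6 * cmod x \<le> cmod (zc ^ m * x - zc ^ n * x)"
    if "m \<noteq> n" "3 \<le> m \<or> 3 \<le> n" for m n
    using mult_right_mono[OF norm_zc_power_diff_ge_6'[OF that], of "cmod x"]
    by (simp add: norm_mult flip: left_diff_distrib)
  \<comment> \<open>An exponent \<open>b\<close> on \<open>y = zc * x\<close> becomes
    \<open>Suc b\<close> on \<open>x\<close>. Hence \<open>a \<noteq> b + 1\<close> says that the
    exponents differ, and a lower bound of 2 on an exponent of \<open>y\<close> becomes 3.\<close>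
  have shift: "zc ^ n * (zc * x) = zc ^ Suc n * x" for n
    by simp
  show ?thesis
    using assms unfolding extra_terms_def
    by (auto simp: d_def T_funpow shift simp del: power_Suc intro!: scale)
qed

text \<open>The cases are \<open>k = 0\<close>, \<open>k < 0\<close>, \<open>k = 1\<close> and
  \<open>k \<ge> 2\<close>; in the second and fourth, comparing moduli is enough.\<close>

lemma X_cases:
  assumes "x \<in> X" "y \<in> X"
  obtains "y = x" | "2 * cmod y \<le> cmod x" | "y = zc * x" | "4 * cmod x \<le> cmod y"
proof -
  obtain m n where xy: "x = zc ^ m" "y = zc ^ n"
    using assms by (auto simp: X_def)
  consider "n = m" | "Suc n \<le> m" | "n = Suc m" | "m + 2 \<le> n" by linarith
  then show ?thesis
  proof cases
    case 2
    then have "(2::real) ^ Suc n \<le> 2 ^ m" by (intro power_increasing) auto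
    then show ?thesis using that xy by (simp add: norm_power)
  next
    case 4
    then have "(2::real) ^ (m + 2) \<le> 2 ^ n" by (intro power_increasing) auto
    then show ?thesis using that xy by (simp add: norm_power power_add)
  qed (use that xy in auto)
qed

lemma d_T_T: "d (T x) (T y) = 2 * cmod (x - y)"
  by (simp add: d_def T_def norm_mult flip: right_diff_distrib)

lemma d_T_self: "d (T x) x = sqrt 7 * cmod x"
proof -
  have "T x - x = (zc - 1) * x" by (simp add: T_def algebra_simps)
  then show ?thesis by (simp add: d_def norm_mult norm_zc_minus_1)
qed

lemma d_T2_T: "d ((T ^^ 2) x) (T x) = 2 * (sqrt 7 * cmod x)"
  using d_T_self[of "T x"] by (simp add: eval_nat_numeral T_def norm_mult)

lemma d_T_T_le:
  assumes "D \<in> extra_terms" "x \<in> X" "y \<in> X"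
  shows "\<exists>t\<in>{d ((T ^^ 2) x) (T x), d (T y) y, D x y}. d (T x) (T y) \<le> 19 / 20 * t"
proof -
  have tri: "cmod (x - y) \<le> cmod x + cmod y" by (rule norm_triangle_ineq4)
  have sqrt7: "50 / 19 * cmod u \<le> sqrt 7 * cmod u" "sqrt 7 * cmod u \<le> 57 / 20 * cmod u" for u
    by (intro mult_right_mono sqrt_7_bounds norm_ge_zero)+
  show ?thesis
    using assms(2,3)
  proof (cases rule: X_cases)
    case 1
    have "d (T x) (T y) \<le> 19 / 20 * d (T y) y"
      using 1 by (simp add: d_T_T d_T_self)
    then show ?thesis by blast
  next
    case 2
    \<comment> \<open>The left side is at most \<open>3 * cmod x\<close>, the right side at least
      \<open>5 * cmod x\<close>.\<close>
    have "d (T x) (T y) \<le> 19 / 20 * d ((T ^^ 2) x) (T x)"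
      unfolding d_T_T d_T2_T using 2 tri sqrt7(1)[of x] norm_ge_zero[of x] by linarith
    then show ?thesis by blast
  next
    case 3
    have "cmod (x - y) = sqrt 7 * cmod x"
      using 3 d_T_self[of x] by (simp add: d_def T_def norm_minus_commute)
    then have "d (T x) (T y) \<le> 19 / 20 * D x y"
      unfolding d_T_T using 3 extra_term_ge[OF assms(1), of x] sqrt7(2)[of x] by simp
    then show ?thesis by blast
  next
    case 4
    \<comment> \<open>Here \<open>cmod (x - y)\<close> is at most
      \<open>5/4 * cmod y\<close>.\<close>
    have "d (T x) (T y) \<le> 19 / 20 * d (T y) y"
      unfolding d_T_T d_T_self using 4 tri sqrt7(1)[of y] by linarith
    then show ?thesis by blast
  qed
qed

theorem claim3:
  "Metric_space X d \<and> Metric_space.mcomplete X d \<and>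
   T \<in> X \<rightarrow> X \<and> \<not> (\<exists>x\<in>X. T x = x) \<and>
   (\<forall>D\<in>extra_terms. \<exists>q::real. 0 < q \<and> q < 1 \<and>
      (\<forall>x\<in>X. \<forall>y\<in>X.
         d (T x) (T y) \<le> q * Max {d x y, d (T x) x, d (T x) y, d (T y) x, d (T y) y,
                                 d ((T ^^ 2) x) x, d ((T ^^ 2) x) y,
                                 d ((T ^^ 2) x) (T x), d ((T ^^ 2) x) (T y), D x y}))"
proof (intro conjI ballI)
  show "T \<in> X \<rightarrow> X"
  proof
    fix x assume "x \<in> X"
    then obtain n where "x = zc ^ n" by (auto simp: X_def)
    then have "T x = zc ^ Suc n" by (simp add: T_def)
    then show "T x \<in> X" unfolding X_def by blast
  qed
  have "zc \<noteq> 1" using norm_zc by force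
  then show "\<not> (\<exists>x\<in>X. T x = x)" using X_nonzero by (auto simp: T_def)
next
  fix D assume D: "D \<in> extra_terms"
  show "\<exists>q::real. 0 < q \<and> q < 1 \<and>
      (\<forall>x\<in>X. \<forall>y\<in>X.
         d (T x) (T y) \<le> q * Max {d x y, d (T x) x, d (T x) y, d (T y) x, d (T y) y,
                                 d ((T ^^ 2) x) x, d ((T ^^ 2) x) y,
                                 d ((T ^^ 2) x) (T x), d ((T ^^ 2) x) (T y), D x y})"
  proof (intro exI[of _ "19 / 20"] conjI ballI)
    fix x y assume "x \<in> X" "y \<in> X"
    then obtain t where t: "t \<in> {d ((T ^^ 2) x) (T x), d (T y) y, D x y}"
      and le: "d (T x) (T y) \<le> 19 / 20 * t"
      using d_T_T_le[OF D] by blast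
    let ?S = "{d x y, d (T x) x, d (T x) y, d (T y) x, d (T y) y, d ((T ^^ 2) x) x,
               d ((T ^^ 2) x) y, d ((T ^^ 2) x) (T x), d ((T ^^ 2) x) (T y), D x y}"
    have "t \<le> Max ?S" using t by (intro Max_ge) blast+
    with le show "d (T x) (T y) \<le> 19 / 20 * Max ?S" by linarith
  qed auto
qed (fact Metric_space_X mcomplete_X)+

end
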